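(* Let $X$ be an Archimedean pervasive pre-Riesz space and $B\subseteq X$ a band such that $X=B\oplus B^{\mathrm{d}}$. Let $(Y,i)$ be a vector lattice cover of $X$, let $\hat B$ be the smallest extension ideal of $B$ in $Y$, and let $\widehat{B^{\mathrm{d}}}$ be the smallest extension ideal of $B^{\mathrm{d}}$ in $Y$. Then the following hold. (i) $Y=\hat B\oplus\hat B^{\mathrm{d}}$. (ii) $\hat B$ equals the smallest extension band of $B$ in $Y$. (iii) $i(B)$ is majorizing in $\hat B$ and $i(B^{\mathrm{d}})$ is majorizing in $\hat B^{\mathrm{d}}$. (iv) $\hat B^{\mathrm{d}}=\widehat{B^{\mathrm{d}}}$. (v) $\hat B$ coincides with every extension band and every extension ideal of $B$ in $Y$. (vi) $\hat B$ and $\hat B^{\mathrm{d}}$ are vector lattice covers of $B$ and $B^{\mathrm{d}}$, respectively (with respect to the restrictions of $i$), and both $B$ and $B^{\mathrm{d}}$ are pervasive. Here $\hat B^{\mathrm{d}}$ denotes the disjoint complement of $\hat B$ in $Y$.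
   Context: All vector spaces are real. An ordered vector space $X$ is a real vector space with a cone $X_+$ (closed under addition and multiplication by nonnegative scalars, $X_+\cap(-X_+)=\{0\}$), ordered by $x\le y$ iff $y-x\in X_+$; linear subspaces carry the induced order. It is Archimedean if $nx\le y$ for all $n\in\mathbb N$ implies $x\le 0$. A linear subspace $D$ of an ordered vector space $Y$ is order dense in $Y$ if $y=\inf\{z\in D: y\le z\}$ for every $y\in Y$, and $D$ is majorizing in $Y$ if for every $y\in Y$ there is $d\in D$ with $y\le d$. An ordered vector space $X$ is a pre-Riesz space if there exist a vector lattice $Y$ and a bipositive linear map $i\colon X\to Y$ (i.e. $i(x)\ge 0$ iff $x\ge 0$) such that $i(X)$ is order dense in $Y$; then $(Y,i)$ is called a vector lattice cover of $X$. A pre-Riesz space $X$ is pervasive if for some (equivalently, every) vector lattice cover $(Y,i)$ of $X$, for every $y\in Y_+$ with $y\ne 0$ there is $x\in X$ with $0<i(x)\le y$. For $M\subseteq X$, $M^u$ is the set of upper bounds of $M$ in $X$. Elements $x,y\in X$ are disjoint, $x\perp y$, if $\{x+y,-x-y\}^u=\{x-y,-x+y\}^u$ (in a vector lattice this is the usual disjointness). The disjoint complement of $M\subseteq X$ is $M^{\mathrm{d}}=\{x\in X: x\perp y\text{ for all }y\in M\}$, and $M^{\mathrm{dd}}=(M^{\mathrm{d}})^{\mathrm{d}}$. A linear subspace $B$ is a band if $B^{\mathrm{dd}}=B$. A subset $M\subseteq X$ is solid if for all $x\in X$, $y\in M$ the inclusion $\{x,-x\}^u\supseteq\{y,-y\}^u$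 implies $x\in M$; an ideal is a solid linear subspace. (These notions apply both to $X$ and to $Y$.) Let $(Y,i)$ be a vector lattice cover of $X$. For $S\subseteq Y$ put $[S]i=\{x\in X: i(x)\in S\}$. An ideal (band) $J$ in $Y$ is an extension ideal (extension band) of an ideal (band) $I$ in $X$ if $I=[J]i$. If $I$ has an extension ideal (band), the intersection of all its extension ideals (bands) in $Y$ is again one, called the smallest extension ideal (band) of $I$. Under the hypotheses here, $B$ and $B^{\mathrm{d}}$ are directed ideals, so they have extension ideals; every band in $X$ has an extension band in $Y$. *)

theory Defs
  imports "HOL-Analysis.Analysis" "HOL-Library.Lub_Glb" "HOL-Library.Lattice_Algebras"
begin

text \<open>
  An ordered vector space is a type of class \<open>ordered_real_vector\<close> or, where the theory
  has to speak about subspaces with the induced order, a linear subspace of such a type. Suprema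
  and infima in a subspace \<open>L\<close> are the relative ones, \<open>isLub L\<close> and \<open>isGlb L\<close>.
\<close>

definition archimedean_order :: "'a::ordered_real_vector set \<Rightarrow> bool"
  where "archimedean_order S \<longleftrightarrow>
    (\<forall>x\<in>S. \<forall>y\<in>S. (\<forall>n::nat. real n *\<^sub>R x \<le> y) \<longrightarrow> x \<le> 0)"

definition is_vector_lattice :: "'b::ordered_real_vector set \<Rightarrow> bool"
  where "is_vector_lattice L \<longleftrightarrow> subspace L \<and>
    (\<forall>x\<in>L. \<forall>y\<in>L. (\<exists>z. isLub L {x, y} z) \<and> (\<exists>z. isGlb L {x, y} z))"

definition order_dense :: "'b::ordered_real_vector set \<Rightarrow> 'b set \<Rightarrow> bool"
  where "order_dense D L \<longleftrightarrow> subspace D \<and> D \<subseteq> L \<and> (\<forall>y\<in>L. isGlb L {z \<in> D. y \<le> z} y)"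

definition majorizing :: "'b::ordered_real_vector set \<Rightarrow> 'b set \<Rightarrow> bool"
  where "majorizing D L \<longleftrightarrow> subspace D \<and> D \<subseteq> L \<and> (\<forall>y\<in>L. \<exists>d\<in>D. y \<le> d)"

text \<open>
  Only the values of \<open>i\<close> on \<open>S\<close> matter below, so that restricting \<open>i\<close> to a smaller subspace
  needs no new function.
\<close>

definition bipositive_linear_on ::
    "'a::ordered_real_vector set \<Rightarrow> ('a \<Rightarrow> 'b::ordered_real_vector) \<Rightarrow> bool"
  where "bipositive_linear_on S i \<longleftrightarrow>
    (\<forall>x\<in>S. \<forall>y\<in>S. i (x + y) = i x + i y) \<and>
    (\<forall>c. \<forall>x\<in>S. i (c *\<^sub>R x) = c *\<^sub>R i x) \<and>
    (\<forall>x\<in>S. 0 \<le> i x \<longleftrightarrow> 0 \<le> x)"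

definition vector_lattice_cover ::
    "'a::ordered_real_vector set \<Rightarrow> 'b::ordered_real_vector set \<Rightarrow> ('a \<Rightarrow> 'b) \<Rightarrow> bool"
  where "vector_lattice_cover S L i \<longleftrightarrow>
    subspace S \<and> is_vector_lattice L \<and> bipositive_linear_on S i \<and> order_dense (i ` S) L"

text \<open>
  HOL cannot quantify over types inside a formula, so the type in which the cover lives is a
  parameter of the next notions. By \<open>pervasive_any_cover\<close> below, the choice of the cover
  (and of its type) is irrelevant for being pervasive.
\<close>

definition pre_riesz :: "'b::ordered_real_vector itself \<Rightarrow> 'a::ordered_real_vector set \<Rightarrow> bool"
  where "pre_riesz T S \<longleftrightarrow> (\<exists>(L :: 'b set) i. vector_lattice_cover S L i)"

definition pervasive_in ::
    "'a::ordered_real_vector set \<Rightarrow> 'b::ordered_real_vector set \<Rightarrow> ('a \<Rightarrow> 'b) \<Rightarrow> bool"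
  where "pervasive_in S L i \<longleftrightarrow> (\<forall>y\<in>L. 0 \<le> y \<and> y \<noteq> 0 \<longrightarrow> (\<exists>x\<in>S. 0 < i x \<and> i x \<le> y))"

definition is_pervasive :: "'b::ordered_real_vector itself \<Rightarrow> 'a::ordered_real_vector set \<Rightarrow> bool"
  where "is_pervasive T S \<longleftrightarrow>
    (\<exists>(L :: 'b set) i. vector_lattice_cover S L i \<and> pervasive_in S L i)"

definition upper_bounds :: "'a::ordered_real_vector set \<Rightarrow> 'a set"
  where "upper_bounds M = {z. M *<= z}"

definition disjoint_elems :: "'a::ordered_real_vector \<Rightarrow> 'a \<Rightarrow> bool"
  where "disjoint_elems x y \<longleftrightarrow>
    upper_bounds {x + y, - x - y} = upper_bounds {x - y, - x + y}"

definition disjoint_compl :: "'a::ordered_real_vector set \<Rightarrow> 'a set"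
  where "disjoint_compl M = {x. \<forall>y\<in>M. disjoint_elems x y}"

definition is_band :: "'a::ordered_real_vector set \<Rightarrow> bool"
  where "is_band B \<longleftrightarrow> subspace B \<and> disjoint_compl (disjoint_compl B) = B"

definition solid :: "'a::ordered_real_vector set \<Rightarrow> bool"
  where "solid M \<longleftrightarrow>
    (\<forall>x. \<forall>y\<in>M. upper_bounds {y, - y} \<subseteq> upper_bounds {x, - x} \<longrightarrow> x \<in> M)"

definition order_ideal :: "'a::ordered_real_vector set \<Rightarrow> bool"
  where "order_ideal I \<longleftrightarrow> subspace I \<and> solid I"

definition extension_ideal ::
    "('a::ordered_real_vector \<Rightarrow> 'b::ordered_real_vector) \<Rightarrow> 'a set \<Rightarrow> 'b set \<Rightarrow> bool"
  where "extension_ideal i I J \<longleftrightarrow> order_ideal I \<and> order_ideal J \<and> I = {x. i x \<in> J}"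

definition extension_band ::
    "('a::ordered_real_vector \<Rightarrow> 'b::ordered_real_vector) \<Rightarrow> 'a set \<Rightarrow> 'b set \<Rightarrow> bool"
  where "extension_band i I J \<longleftrightarrow> is_band I \<and> is_band J \<and> I = {x. i x \<in> J}"

text \<open>If there is no extension ideal (band) at all, the intersections are the junk value \<open>UNIV\<close>.\<close>

definition smallest_extension_ideal ::
    "('a::ordered_real_vector \<Rightarrow> 'b::ordered_real_vector) \<Rightarrow> 'a set \<Rightarrow> 'b set"
  where "smallest_extension_ideal i I = \<Inter> {J. extension_ideal i I J}"

definition smallest_extension_band ::
    "('a::ordered_real_vector \<Rightarrow> 'b::ordered_real_vector) \<Rightarrow> 'a set \<Rightarrow> 'b set"
  where "smallest_extension_band i I = \<Inter> {J. extension_band i I J}"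

definition direct_sum_decomposition :: "'a::real_vector set \<Rightarrow> 'a set \<Rightarrow> bool"
  where "direct_sum_decomposition A C \<longleftrightarrow> subspace A \<and> subspace C \<and> A \<inter> C = {0} \<and>
    {a + c | a c. a \<in> A \<and> c \<in> C} = UNIV"

lemma bipositive_linear_on_le_iff:
  assumes "subspace S" "bipositive_linear_on S i" "x \<in> S" "y \<in> S"
  shows "i x \<le> i y \<longleftrightarrow> x \<le> y"
proof -
  have m: "(-1) *\<^sub>R x \<in> S" using assms(1,3) by (rule subspace_scale)
  have "i (a + b) = i a + i b" if "a \<in> S" "b \<in> S" for a b
    using assms(2) that by (simp add: bipositive_linear_on_def)
  then have "i (y + (-1) *\<^sub>R x) = i y + i ((-1) *\<^sub>R x)"
    using assms(4) m by this
  also have "i ((-1) *\<^sub>R x) = (-1) *\<^sub>R i x"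
    using assms(2,3) by (simp only: bipositive_linear_on_def)
  finally have "i (y - x) = i y - i x" by simp
  moreover have "y - x \<in> S" using assms(1,3,4) by (simp add: subspace_diff)
  ultimately show ?thesis
    using assms(2) unfolding bipositive_linear_on_def by (metis diff_ge_0_iff_ge)
qed

lemma bipositive_linear_on_zero:
  assumes "subspace S" "bipositive_linear_on S i"
  shows "i 0 = 0"
  using assms subspace_0[OF assms(1)] unfolding bipositive_linear_on_def
  by (metis scaleR_zero_left)

text \<open>A characterization of pervasive spaces which does not mention the cover.\<close>

lemma pervasive_in_iff:
  assumes "vector_lattice_cover S L i"
  shows "pervasive_in S L i \<longleftrightarrow>
    (\<forall>x\<in>S. \<not> x \<le> 0 \<longrightarrow> (\<exists>z\<in>S. 0 < z \<and> (\<forall>u\<in>S. x \<le> u \<and> 0 \<le> u \<longrightarrow> z \<le> u)))"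
    (is "_ \<longleftrightarrow> ?R")
proof -
  have S: "subspace S" and L: "is_vector_lattice L" and bi: "bipositive_linear_on S i"
    and od: "order_dense (i ` S) L"
    using assms unfolding vector_lattice_cover_def by auto
  have sub: "subspace L" using L unfolding is_vector_lattice_def by blast
  have le: "i x \<le> i y \<longleftrightarrow> x \<le> y" if "x \<in> S" "y \<in> S" for x y
    using bipositive_linear_on_le_iff[OF S bi] that by blast
  have i0: "i 0 = 0" by (rule bipositive_linear_on_zero[OF S bi])
  have S0: "0 \<in> S" using S by (rule subspace_0)
  have L0: "0 \<in> L" using sub by (rule subspace_0)
  have iL: "i x \<in> L" if "x \<in> S" for x
    using od that unfolding order_dense_def by blast
  have le0: "i x \<le> 0 \<longleftrightarrow> x \<le> 0" "0 \<le> i x \<longleftrightarrow> 0 \<le> x" if "x \<in> S" for x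
    using le[OF that S0] le[OF S0 that] i0 by simp_all
  have lt0: "0 < i x \<longleftrightarrow> 0 < x" if "x \<in> S" for x
    using le0[OF that] by (simp add: less_le_not_le)
  have glb: "isGlb L {z \<in> i ` S. y \<le> z} y" if "y \<in> L" for y
    using od that unfolding order_dense_def by blast
  have glb_le: "w \<le> y" if "y \<in> L" "w \<in> L" "\<And>u. u \<in> S \<Longrightarrow> y \<le> i u \<Longrightarrow> w \<le> i u" for w y
  proof (rule isGlb_le_isLb[OF glb[OF that(1)]])
    show "isLb L {z \<in> i ` S. y \<le> z} w"
      using that(2,3) by (auto simp: isLb_def setge_def)
  qed
  show ?thesis
  proof
    assume P: "pervasive_in S L i"
    show ?R
    proof (intro ballI impI)
      fix x assume x: "x \<in> S" "\<not> x \<le> 0"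
      obtain p where p: "isLub L {i x, 0} p"
        using L iL[OF x(1)] L0 unfolding is_vector_lattice_def by blast
      have pL: "p \<in> L" using p by (rule isLubD1a)
      have p1: "i x \<le> p" "0 \<le> p" using isLubD2[OF p] by auto
      have "p \<noteq> 0" using p1 x le0 by auto
      then obtain z where z: "z \<in> S" "0 < i z" "i z \<le> p"
        using P pL p1 unfolding pervasive_in_def by blast
      have "z \<le> u" if u: "u \<in> S" "x \<le> u" "0 \<le> u" for u
      proof -
        have "isUb L {i x, 0} (i u)"
          using u le[OF x(1) u(1)] le0[OF u(1)] iL by (auto simp: isUb_def setle_def)
        then have "p \<le> i u" using p by (rule isLub_le_isUb[rotated])
        then show ?thesis using z le[OF z(1) u(1)] by auto
      qed
      then show "\<exists>z\<in>S. 0 < z \<and> (\<forall>u\<in>S. x \<le> u \<and> 0 \<le> u \<longrightarrow> z \<le> u)"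
        using z lt0 by blast
    qed
  next
    assume R: ?R
    show "pervasive_in S L i"
      unfolding pervasive_in_def
    proof (intro ballI impI)
      fix y assume y: "y \<in> L" "0 \<le> y \<and> y \<noteq> 0"
      have mL: "- y \<in> L" using sub y(1) by (rule subspace_neg)
      have "\<not> 0 \<le> - y" using y(2) by auto
      then obtain s where s: "s \<in> S" "- y \<le> i s" "\<not> 0 \<le> i s"
        using glb_le[OF mL L0] by blast
      have ms: "- s \<in> S" using S s(1) by (rule subspace_neg)
      have "i ((-1) *\<^sub>R s) = (-1) *\<^sub>R i s"
        using bi s(1) by (simp only: bipositive_linear_on_def)
      then have ims: "i (- s) = - i s" by simp
      have "\<not> - s \<le> 0" using s le0 by simp
      then obtain z where z: "z \<in> S" "0 < z" "\<forall>u\<in>S. - s \<le> u \<and> 0 \<le> u \<longrightarrow> z \<le> u"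
        using R ms by blast
      have "i z \<le> y"
      proof (rule glb_le[OF y(1) iL[OF z(1)]])
        fix u assume u: "u \<in> S" "y \<le> i u"
        have "i (- s) \<le> y" using s(2) ims by (simp add: minus_le_iff)
        then have "- s \<le> u" using u le[OF ms u(1)] by auto
        moreover have "0 \<le> u" using u y(2) le0[OF u(1)] by auto
        ultimately show "i z \<le> i u" using z u le[OF z(1) u(1)] by blast
      qed
      then show "\<exists>x\<in>S. 0 < i x \<and> i x \<le> y" using z lt0 by blast
    qed
  qed
qed

lemma pervasive_any_cover:
  fixes S :: "'a::ordered_real_vector set"
  assumes "is_pervasive TYPE('b::ordered_real_vector) S" "vector_lattice_cover S L i"
  shows "pervasive_in S L i"
proof -
  obtain L' :: "'b set" and i' where c: "vector_lattice_cover S L' i'" "pervasive_in S L' i'"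
    using assms(1) unfolding is_pervasive_def by blast
  show ?thesis
    using c(2) unfolding pervasive_in_iff[OF c(1)] pervasive_in_iff[OF assms(2)] .
qed

end

theory Submission
  imports Defs
begin

text \<open>
  Let \<open>J\<close> and \<open>K\<close> be the ideals of \<open>Y\<close> generated by \<open>i(B)\<close> and \<open>i(B\<^sup>d)\<close>. The embedding \<open>i\<close> preserves
  and reflects disjointness (\<open>disjoint_iff\<close>), because \<open>i(X)\<close> is order dense and bipositively
  embedded. If a sum of two disjoint elements is positive, then so are both summands
  (\<open>disjoint_sum_nonneg\<close>); so the projections of \<open>X = B \<oplus> B\<^sup>d\<close> are positive and \<open>B\<close>, \<open>B\<^sup>d\<close> are
  directed. Hence \<open>J = {y. \<exists>b\<in>B. \<bar>y\<bar> \<le> i b}\<close>, likewise for \<open>K\<close>, so \<open>J\<close> and \<open>K\<close> are disjoint. Every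
  \<open>y \<ge> 0\<close> in \<open>Y\<close> lies below some \<open>i b + i c\<close> with \<open>0 \<le> b \<in> B\<close> and \<open>0 \<le> c \<in> B\<^sup>d\<close>, and the Riesz
  decomposition property splits it into an element of \<open>J\<close> and one of \<open>K\<close>. Therefore
  \<open>Y = J \<oplus> K\<close>, which makes \<open>J\<close> and \<open>K\<close> complementary bands, whose preimages are \<open>B\<close> and \<open>B\<^sup>d\<close>.

  By construction \<open>i(B)\<close> majorizes \<open>J\<close>. It is also order dense in \<open>J\<close>: if \<open>y \<in> J\<close> and
  \<open>y \<le> i x = i b + i c\<close>, then \<open>i b - y\<close> and \<open>i c\<close> are disjoint with a positive sum, so that already
  \<open>y \<le> i b \<le> i x\<close>. Hence \<open>J\<close> is a vector lattice cover of \<open>B\<close>, and \<open>B\<close> inherits pervasiveness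
  because \<open>J\<close> is solid.

  Pervasiveness also yields the uniqueness (\<open>extension_ideal_unique\<close>). An extension ideal of \<open>B\<close>
  contains \<open>J\<close>. If it contained an element with a nonzero component in \<open>K\<close>, there would be \<open>x\<close> with
  \<open>0 < i x\<close> below the modulus of that component, and \<open>x\<close> would lie in \<open>B \<inter> B\<^sup>d = {0}\<close>. As bands
  are ideals, \<open>J\<close> is thus the only extension ideal and the only extension band of \<open>B\<close>, in
  particular the smallest ones. The situation is symmetric in \<open>B\<close> and \<open>B\<^sup>d\<close>, which the locale
  \<open>band_splitting\<close> exploits.
\<close>

section \<open>Modulus and disjointness in a vector lattice\<close>

text \<open>
  The modulus \<open>\<bar>x\<bar>\<close>, given by the supremum so that it depends on the order alone and not on an
  operation \<open>abs\<close> of the type.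
\<close>

definition modulus :: "'b::lattice_ab_group_add \<Rightarrow> 'b"
  where "modulus x = sup x (- x)"

lemma modulus_le_iff: "modulus x \<le> z \<longleftrightarrow> x \<le> z \<and> - x \<le> z"
  by (simp add: modulus_def)

lemma le_modulus: "x \<le> modulus x" "- x \<le> modulus x"
  by (simp_all add: modulus_def)

lemma modulus_nonneg: "0 \<le> modulus x"
proof -
  have "x + - x \<le> modulus x + modulus x"
    by (intro add_mono le_modulus)
  then show ?thesis by simp
qed

lemma modulus_of_nonneg: "0 \<le> x \<Longrightarrow> modulus x = x"
  unfolding modulus_def by (rule sup_absorb1) (meson neg_le_0_iff_le order_trans)

lemma modulus_zero_iff: "modulus x = 0 \<longleftrightarrow> x = 0"
proof
  assume "modulus x = 0"
  then have "x \<le> 0" "- x \<le> 0" using le_modulus[of x] by auto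
  then show "x = 0" by auto
qed (simp add: modulus_def)

lemma modulus_minus: "modulus (- x) = modulus x"
  by (simp add: modulus_def sup.commute)

lemma modulus_add_le: "modulus (x + y) \<le> modulus x + modulus y"
proof -
  have "- (x + y) = - x + - y" by simp
  then show ?thesis
    unfolding modulus_le_iff by (metis add_mono le_modulus)
qed

lemma modulus_diff_add_inf: "modulus (x - y) + inf x y = sup x y"
proof (rule antisym)
  have *: "p - q \<le> s - m" if "p + m \<le> s + q" for p q s m :: 'a
    using that by (simp add: algebra_simps)
  have "x + inf x y \<le> sup x y + y" "y + inf x y \<le> sup x y + x"
    by (intro add_mono; simp)+
  then have "modulus (x - y) \<le> sup x y - inf x y"
    unfolding modulus_le_iff minus_diff_eq by (blast intro: *)
  then show "modulus (x - y) + inf x y \<le> sup x y"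
    by (simp only: le_diff_eq)
  have "x - modulus (x - y) \<le> y" "y - modulus (x - y) \<le> x"
    using le_modulus[of "x - y"] by (simp_all add: algebra_simps)
  moreover have "x - modulus (x - y) \<le> x" "y - modulus (x - y) \<le> y"
    using modulus_nonneg[of "x - y"] by (simp_all add: algebra_simps)
  ultimately have "x - modulus (x - y) \<le> inf x y" "y - modulus (x - y) \<le> inf x y"
    by (blast intro: le_infI)+
  then have "x \<le> modulus (x - y) + inf x y" "y \<le> modulus (x - y) + inf x y"
    by (simp_all only: diff_le_eq add.commute)
  then show "sup x y \<le> modulus (x - y) + inf x y"
    by (rule le_supI)
qed

text \<open>The lattice of a lattice ordered group is distributive.\<close>

lemma inf_sup_distrib_lattice_group:
  fixes x y z :: "'b::lattice_ab_group_add"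
  shows "inf x (sup y z) = sup (inf x y) (inf x z)"
proof (rule antisym)
  let ?t = "sup (inf x y) (inf x z)" and ?s = "sup x (sup y z)"
  have e: "w = inf x w + sup x w - x" for w
    using add_eq_inf_sup[of x w] by (simp add: algebra_simps)
  have "inf x y + sup x y \<le> ?t + ?s" "inf x z + sup x z \<le> ?t + ?s"
    by (intro add_mono; simp add: le_supI1 le_supI2)+
  then have "y \<le> ?t + ?s - x" "z \<le> ?t + ?s - x"
    using e[of y] e[of z] by (metis diff_right_mono)+
  then have "sup y z \<le> ?t + ?s - x" by simp
  then have "inf x (sup y z) + ?s - x \<le> ?t + ?s - x"
    using e[of "sup y z"] by simp
  then show "inf x (sup y z) \<le> ?t" by simp
qed (auto intro: le_infI2)

lemma inf_add_le:
  fixes x a b :: "'b::lattice_ab_group_add"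
  assumes "0 \<le> x" "0 \<le> a" "0 \<le> b"
  shows "inf x (a + b) \<le> inf x a + inf x b"
proof -
  have "inf x a + inf x b = inf (inf (x + x) (a + x)) (inf (x + b) (a + b))"
    by (simp add: add_inf_distrib_left add_inf_distrib_right)
  moreover have "x \<le> x + x" "x \<le> a + x" "x \<le> x + b"
    using assms by simp_all
  ultimately show ?thesis
    by (simp add: le_infI1)
qed

lemma upper_bounds_modulus:
  fixes x :: "'b::{ordered_real_vector, lattice_ab_group_add}"
  shows "upper_bounds {x, - x} = {z. modulus x \<le> z}"
  by (auto simp: upper_bounds_def setle_def modulus_le_iff)

lemma disjoint_elems_modulus_eq:
  fixes x y :: "'b::{ordered_real_vector, lattice_ab_group_add}"
  shows "disjoint_elems x y \<longleftrightarrow> modulus (x + y) = modulus (x - y)"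
proof -
  have "- x - y = - (x + y)" "- x + y = - (x - y)" by simp_all
  then have "disjoint_elems x y \<longleftrightarrow> {z. modulus (x + y) \<le> z} = {z. modulus (x - y) \<le> z}"
    unfolding disjoint_elems_def by (simp only: upper_bounds_modulus)
  also have "\<dots> \<longleftrightarrow> modulus (x + y) = modulus (x - y)"
    by (metis antisym mem_Collect_eq order_refl)
  finally show ?thesis .
qed

text \<open>In a vector lattice, the order theoretic disjointness is \<open>\<bar>x\<bar> \<sqinter> \<bar>y\<bar> = 0\<close>.\<close>

lemma disjoint_elems_iff_inf:
  fixes x y :: "'b::{ordered_real_vector, lattice_ab_group_add}"
  shows "disjoint_elems x y \<longleftrightarrow> inf (modulus x) (modulus y) = 0"
  unfolding disjoint_elems_modulus_eq
proof
  assume e: "modulus (x + y) = modulus (x - y)"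
  \<comment> \<open>The rule \<open>2 (p \<sqinter> q) = p + q - \<bar>p - q\<bar>\<close> applied to \<open>p = \<plusminus>x\<close> and \<open>q = \<plusminus>y\<close>.\<close>
  have *: "inf p q \<le> 0" if "p + q \<le> modulus (p - q)" for p q :: 'b
  proof -
    have "inf p q + inf p q + modulus (p - q) = p + q"
      using add_eq_inf_sup[of p q] modulus_diff_add_inf[of p q] by (simp add: ac_simps)
    then have "inf p q + inf p q + modulus (p - q) \<le> 0 + modulus (p - q)"
      using that by simp
    then have "inf p q + inf p q \<le> 0"
      by (simp only: add_le_cancel_right)
    then show ?thesis by simp
  qed
  have "x + y \<le> modulus (x - y)" "x + - y \<le> modulus (x - - y)"
    "- x + y \<le> modulus (- x - y)" "- x + - y \<le> modulus (- x - - y)"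
    using e le_modulus[of "x + y"] le_modulus[of "x - y"]
      modulus_minus[of "x + y"] modulus_minus[of "x - y"] by simp_all
  note pairs = this[THEN *]
  have "inf (modulus x) (modulus y) \<le> 0"
    unfolding modulus_def inf_sup_distrib_lattice_group
      inf_commute[of "sup x (- x)"] le_sup_iff
    using pairs by (simp only: inf_commute simp_thms)
  then show "inf (modulus x) (modulus y) = 0"
    by (simp add: antisym modulus_nonneg)
next
  have le: "modulus (x + y) \<le> modulus (x - y)"
    if d: "inf (modulus x) (modulus y) = 0" for x y :: 'b
  proof -
    have "modulus (x + y) \<le> modulus x + modulus y"
      by (rule modulus_add_le)
    also have "\<dots> = modulus (modulus x - modulus y)"
      using d add_eq_inf_sup[of "modulus x" "modulus y"]
        modulus_diff_add_inf[of "modulus x" "modulus y"] by simp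
    also have "\<dots> \<le> modulus (x - y)"
      using modulus_add_le[of "x - y" y] modulus_add_le[of "y - x" x] modulus_minus[of "x - y"]
      by (simp add: modulus_le_iff algebra_simps)
    finally show ?thesis .
  qed
  assume "inf (modulus x) (modulus y) = 0"
  then show "modulus (x + y) = modulus (x - y)"
    using le[of x y] le[of x "- y"] by (simp add: modulus_minus antisym)
qed

lemma disjoint_elems_sym:
  fixes x y :: "'b::{ordered_real_vector, lattice_ab_group_add}"
  shows "disjoint_elems x y \<Longrightarrow> disjoint_elems y x"
  by (simp add: disjoint_elems_iff_inf inf_commute)

lemma disjoint_elems_self_iff:
  fixes x :: "'b::{ordered_real_vector, lattice_ab_group_add}"
  shows "disjoint_elems x x \<longleftrightarrow> x = 0"
  by (simp add: disjoint_elems_iff_inf modulus_zero_iff)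

lemma disjoint_elems_mono:
  fixes x y :: "'b::{ordered_real_vector, lattice_ab_group_add}"
  assumes "disjoint_elems x y" "modulus x' \<le> modulus x" "modulus y' \<le> modulus y"
  shows "disjoint_elems x' y'"
  using assms inf_mono[OF assms(2,3)]
  by (simp add: disjoint_elems_iff_inf antisym modulus_nonneg)

lemma disjoint_elems_add:
  fixes x y z :: "'b::{ordered_real_vector, lattice_ab_group_add}"
  assumes "disjoint_elems z x" "disjoint_elems z y"
  shows "disjoint_elems z (x + y)"
proof -
  have "inf (modulus z) (modulus (x + y)) \<le> inf (modulus z) (modulus x + modulus y)"
    by (intro inf_mono order_refl modulus_add_le)
  also have "\<dots> \<le> inf (modulus z) (modulus x) + inf (modulus z) (modulus y)"
    by (intro inf_add_le modulus_nonneg)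
  finally show ?thesis
    using assms by (simp add: disjoint_elems_iff_inf antisym modulus_nonneg)
qed

lemma disjoint_sum_nonneg:
  fixes u v :: "'b::{ordered_real_vector, lattice_ab_group_add}"
  assumes "disjoint_elems u v" "0 \<le> u + v"
  shows "0 \<le> u"
proof -
  have "- u \<le> v" using assms(2) by (metis add.commute diff_ge_0_iff_ge diff_minus_eq_add)
  then have "- u \<le> inf (modulus u) (modulus v)"
    using le_modulus order_trans by (metis le_inf_iff)
  also have "\<dots> = 0"
    using assms(1) by (simp only: disjoint_elems_iff_inf)
  finally show ?thesis by simp
qed

lemma riesz_decomposition:
  fixes y a b :: "'b::lattice_ab_group_add"
  assumes "0 \<le> y" "0 \<le> a" "0 \<le> b" "y \<le> a + b"
  obtains y1 y2 where "y = y1 + y2" "0 \<le> y1" "y1 \<le> a" "0 \<le> y2" "y2 \<le> b"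
proof
  show "y = inf y a + (y - inf y a)" by (simp only: add_diff_cancel_left' add_diff_eq)
  have "y - b \<le> inf y a"
    using assms by (simp add: diff_le_eq)
  then show "y - inf y a \<le> b"
    by (simp only: diff_le_eq add.commute)
  show "0 \<le> y - inf y a" by (simp only: diff_ge_0_iff_ge inf_le1)
qed (use assms in simp_all)

lemma solid_iff_modulus:
  fixes M :: "'b::{ordered_real_vector, lattice_ab_group_add} set"
  shows "solid M \<longleftrightarrow> (\<forall>x. \<forall>y\<in>M. modulus x \<le> modulus y \<longrightarrow> x \<in> M)"
proof -
  have "{z. modulus y \<le> z} \<subseteq> {z. modulus x \<le> z} \<longleftrightarrow> modulus x \<le> modulus y" for x y :: 'b
    by (auto intro: order_trans)
  then show ?thesis
    unfolding solid_def upper_bounds_modulus by simp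
qed

lemma band_imp_order_ideal:
  fixes J :: "'b::{ordered_real_vector, lattice_ab_group_add} set"
  assumes "is_band J"
  shows "order_ideal J"
proof -
  have "solid (disjoint_compl M)" for M :: "'b set"
    unfolding solid_iff_modulus disjoint_compl_def
    by (blast intro: disjoint_elems_mono order_refl)
  then show ?thesis
    using assms unfolding is_band_def order_ideal_def by metis
qed

section \<open>Splitting a vector lattice cover along complementary subspaces\<close>

text \<open>
  For a directed subspace \<open>B\<close> and a positive linear map \<open>i\<close> this is the ideal generated by \<open>i(B)\<close>.
  The bounds satisfy \<open>0 \<le> i b\<close> automatically.
\<close>

definition dominated_by ::
    "('a \<Rightarrow> 'b::lattice_ab_group_add) \<Rightarrow> 'a set \<Rightarrow> 'b set"
  where "dominated_by i B = {y. \<exists>b\<in>B. modulus y \<le> i b}"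

text \<open>A pervasive space \<open>X = B \<oplus> C\<close> with vector lattice cover \<open>(Y, i)\<close>, \<open>C = B\<^sup>d\<close> and \<open>B = C\<^sup>d\<close>.\<close>

locale band_splitting =
  fixes i :: "'a::ordered_real_vector \<Rightarrow> 'b::{ordered_real_vector, lattice_ab_group_add}"
    and B C :: "'a set"
  assumes cover: "vector_lattice_cover UNIV UNIV i"
    and perv: "pervasive_in UNIV UNIV i"
    and splitting: "direct_sum_decomposition B C"
    and compl_B: "disjoint_compl B = C"
    and compl_C: "disjoint_compl C = B"
begin

lemma subspaces: "subspace B" "subspace C" and inter: "B \<inter> C = {0}"
  using splitting by (auto simp: direct_sum_decomposition_def)

lemma decompose: obtains b c where "b \<in> B" "c \<in> C" "x = b + c"
  using splitting unfolding direct_sum_decomposition_def by blast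

lemma swapped: "band_splitting i C B"
proof
  have "{c + b | c b. c \<in> C \<and> b \<in> B} = {b + c | b c. b \<in> B \<and> c \<in> C}"
    by (metis (no_types, opaque_lifting) add.commute)
  then show "direct_sum_decomposition C B"
    using splitting by (simp add: direct_sum_decomposition_def Int_commute)
qed (fact cover perv compl_B compl_C)+

lemma bipositive: "bipositive_linear_on UNIV i"
  using cover by (simp add: vector_lattice_cover_def)

lemma i_add: "i (x + y) = i x + i y" and i_scale: "i (r *\<^sub>R x) = r *\<^sub>R i x"
  using bipositive by (simp_all add: bipositive_linear_on_def)

lemma i_minus: "i (- x) = - i x"
  using i_scale[of "-1" x] by simp

lemma i_diff: "i (x - y) = i x - i y"
  using i_add[of x "- y"] by (simp add: i_minus)

lemma i_zero: "i 0 = 0"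
  using bipositive_linear_on_zero[OF subspace_UNIV bipositive] .

lemma i_le_iff: "i x \<le> i y \<longleftrightarrow> x \<le> y"
  using bipositive_linear_on_le_iff[OF subspace_UNIV bipositive] by simp

lemma i_nonneg_iff: "0 \<le> i x \<longleftrightarrow> 0 \<le> x"
  using i_le_iff[of 0 x] by (simp add: i_zero)

text \<open>To bound \<open>y\<close> from below, it suffices to bound the elements of \<open>i(X)\<close> above \<open>y\<close>.\<close>

lemma le_by_density:
  assumes "\<And>x. y \<le> i x \<Longrightarrow> w \<le> i x"
  shows "w \<le> y"
proof -
  have "isGlb UNIV {z \<in> range i. y \<le> z} y"
    using cover by (simp add: vector_lattice_cover_def order_dense_def)
  then show ?thesis
    by (rule isGlb_le_isLb) (use assms in \<open>auto simp: isLb_def setge_def\<close>)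
qed

text \<open>
  Order density entails that \<open>i(X)\<close> is majorizing: an element without upper bounds in \<open>i(X)\<close>
  would be the infimum of the empty set, hence the greatest element of \<open>Y\<close>, hence at most
  \<open>0 = i 0\<close>.
\<close>

lemma majorized: "\<exists>x. y \<le> i x"
proof (rule ccontr)
  assume "\<nexists>x. y \<le> i x"
  then have top: "w \<le> y" for w
    by (blast intro: le_by_density)
  have "y \<le> 0" using top[of "y + y"] by simp
  then show False
    using \<open>\<nexists>x. y \<le> i x\<close> i_zero by metis
qed

lemma upper_bounds_i:
  "z \<in> upper_bounds {x, - x} \<longleftrightarrow> modulus (i x) \<le> i z"
  by (simp add: upper_bounds_def setle_def modulus_le_iff i_le_iff flip: i_minus)

lemma upper_bounds_subset_iff:
  "upper_bounds {y, - y} \<subseteq> upper_bounds {x, - x} \<longleftrightarrow> modulus (i x) \<le> modulus (i y)"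
  unfolding subset_iff upper_bounds_i by (meson le_by_density order_trans)

lemma disjoint_iff: "disjoint_elems (i x) (i y) \<longleftrightarrow> disjoint_elems x y"
proof -
  have "- x - y = - (x + y)" "- x + y = - (x - y)" by simp_all
  then have "disjoint_elems x y \<longleftrightarrow> upper_bounds {x + y, - (x + y)} = upper_bounds {x - y, - (x - y)}"
    unfolding disjoint_elems_def by simp
  also have "\<dots> \<longleftrightarrow> modulus (i x + i y) = modulus (i x - i y)"
    unfolding set_eq_subset upper_bounds_subset_iff i_add i_diff by auto
  finally show ?thesis
    by (simp add: disjoint_elems_modulus_eq)
qed

lemma disjoint_B_C: "b \<in> B \<Longrightarrow> c \<in> C \<Longrightarrow> disjoint_elems (i b) (i c)"
  using compl_C unfolding disjoint_iff disjoint_compl_def by blast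

lemma decompose_nonneg:
  assumes "0 \<le> x"
  obtains b c where "b \<in> B" "c \<in> C" "x = b + c" "0 \<le> b" "0 \<le> c"
proof -
  obtain b c where x: "b \<in> B" "c \<in> C" "x = b + c"
    by (rule decompose)
  have d: "disjoint_elems (i b) (i c)"
    using x by (simp add: disjoint_B_C)
  have "0 \<le> i b + i c"
    using assms x i_nonneg_iff by (metis i_add)
  then have "0 \<le> b" "0 \<le> c"
    using disjoint_sum_nonneg[OF d] disjoint_sum_nonneg[OF disjoint_elems_sym[OF d]]
    by (simp_all add: i_nonneg_iff add.commute)
  with x show thesis by (rule that)
qed

lemma dominate_modulus:
  obtains b c where "b \<in> B" "c \<in> C" "0 \<le> b" "0 \<le> c" "modulus y \<le> i b + i c"
proof -
  obtain x where x: "modulus y \<le> i x"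
    using majorized by blast
  then have "0 \<le> x"
    using modulus_nonneg order_trans i_nonneg_iff by blast
  then show thesis
    by (rule decompose_nonneg) (metis that i_add x)
qed

abbreviation "J \<equiv> dominated_by i B"
abbreviation "K \<equiv> dominated_by i C"

lemma J_solid:
  assumes "y \<in> J" "modulus x \<le> modulus y"
  shows "x \<in> J"
  using assms unfolding dominated_by_def by (blast intro: order_trans)

lemma disjoint_J_K:
  assumes "y \<in> J" "z \<in> K"
  shows "disjoint_elems y z"
proof -
  obtain b c where bc: "b \<in> B" "modulus y \<le> i b" "c \<in> C" "modulus z \<le> i c"
    using assms unfolding dominated_by_def by blast
  have "modulus y \<le> modulus (i b)" "modulus z \<le> modulus (i c)"
    using bc le_modulus order_trans by blast+
  then show ?thesis
    using disjoint_B_C[OF bc(1,3)] by (blast intro: disjoint_elems_mono)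
qed

lemma J_subspace: "subspace J"
proof (rule subspaceI)
  show "0 \<in> J"
    using subspace_0[OF subspaces(1)]
    by (auto simp: dominated_by_def modulus_def i_zero intro!: bexI[of _ 0])
next
  fix x y assume "x \<in> J" "y \<in> J"
  then obtain a b where ab: "a \<in> B" "b \<in> B" "modulus x \<le> i a" "modulus y \<le> i b"
    unfolding dominated_by_def by blast
  have "modulus (x + y) \<le> modulus x + modulus y" by (rule modulus_add_le)
  also have "\<dots> \<le> i (a + b)" unfolding i_add using ab by (intro add_mono)
  finally show "x + y \<in> J"
    using subspace_add[OF subspaces(1)] ab unfolding dominated_by_def by blast
next
  fix r :: real and x assume "x \<in> J"
  then obtain b where b: "b \<in> B" "modulus x \<le> i b"
    unfolding dominated_by_def by blast
  have "x \<le> i b" "- x \<le> i b" using b by (simp_all add: modulus_le_iff)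
  then have "\<bar>r\<bar> *\<^sub>R x \<le> i (\<bar>r\<bar> *\<^sub>R b)" "\<bar>r\<bar> *\<^sub>R (- x) \<le> i (\<bar>r\<bar> *\<^sub>R b)"
    unfolding i_scale by (intro scaleR_left_mono; simp)+
  then have "modulus (r *\<^sub>R x) \<le> i (\<bar>r\<bar> *\<^sub>R b)"
    by (cases "r \<ge> 0") (simp_all add: modulus_le_iff)
  then show "r *\<^sub>R x \<in> J"
    using subspace_scale[OF subspaces(1) b(1)] unfolding dominated_by_def by blast
qed

lemma J_order_ideal: "order_ideal J"
  unfolding order_ideal_def solid_iff_modulus using J_subspace J_solid by blast

lemma K_subspace: "subspace K"
  by (rule band_splitting.J_subspace[OF swapped])

lemma K_solid: "y \<in> K \<Longrightarrow> modulus x \<le> modulus y \<Longrightarrow> x \<in> K"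
  by (rule band_splitting.J_solid[OF swapped])

lemma J_K_decompose:
  obtains y1 y2 where "y1 \<in> J" "y2 \<in> K" "y = y1 + y2"
proof -
  have pos: "\<exists>y1\<in>J. \<exists>y2\<in>K. y = y1 + y2" if y0: "0 \<le> y" for y
  proof -
    obtain b c where bc: "b \<in> B" "c \<in> C" "0 \<le> b" "0 \<le> c" "modulus y \<le> i b + i c"
      by (rule dominate_modulus)
    obtain y1 y2 where y: "y = y1 + y2" "0 \<le> y1" "y1 \<le> i b" "0 \<le> y2" "y2 \<le> i c"
    proof (rule riesz_decomposition[of y "i b" "i c"])
      show "y \<le> i b + i c" using y0 bc by (simp add: modulus_of_nonneg)
    qed (use y0 bc in \<open>simp_all add: i_nonneg_iff\<close>)
    then have "y1 \<in> J" "y2 \<in> K"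
      using bc by (auto simp: dominated_by_def modulus_of_nonneg)
    then show ?thesis
      using y(1) by blast
  qed
  have "modulus y - y \<ge> 0" by (simp add: le_modulus)
  then obtain m1 m2 n1 n2 where *: "m1 \<in> J" "m2 \<in> K" "modulus y = m1 + m2"
    "n1 \<in> J" "n2 \<in> K" "modulus y - y = n1 + n2"
    using pos modulus_nonneg by meson
  show thesis
  proof
    show "m1 - n1 \<in> J" "m2 - n2 \<in> K"
      using * J_subspace K_subspace by (auto intro: subspace_diff)
    show "y = (m1 - n1) + (m2 - n2)"
      using *(3,6) by (simp add: algebra_simps)
  qed
qed

text \<open>
  If \<open>z = z1 + z2\<close> is disjoint from \<open>J\<close>, its component \<open>z1\<close> in \<open>J\<close> is disjoint from \<open>z\<close> and from
  \<open>z2\<close>, hence from itself.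
\<close>

lemma disjoint_compl_J: "disjoint_compl J = K"
proof
  show "K \<subseteq> disjoint_compl J"
    using disjoint_J_K disjoint_elems_sym unfolding disjoint_compl_def by blast
next
  show "disjoint_compl J \<subseteq> K"
  proof
    fix z assume z: "z \<in> disjoint_compl J"
    obtain z1 z2 where s: "z1 \<in> J" "z2 \<in> K" "z = z1 + z2"
      by (rule J_K_decompose)
    have "disjoint_elems z1 z"
      using z s(1) disjoint_elems_sym unfolding disjoint_compl_def by blast
    moreover have "disjoint_elems z1 (- z2)"
      using s K_subspace by (simp add: disjoint_J_K subspace_neg)
    ultimately have "disjoint_elems z1 (z + - z2)"
      by (rule disjoint_elems_add)
    then have "z1 = 0"
      using s(3) by (simp add: disjoint_elems_self_iff)
    then show "z \<in> K" using s by simp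
  qed
qed

lemma disjoint_compl_K: "disjoint_compl K = J"
  by (rule band_splitting.disjoint_compl_J[OF swapped])

lemma J_band: "is_band J"
  by (simp add: is_band_def J_subspace disjoint_compl_J disjoint_compl_K)

lemma J_inter_K: "J \<inter> K = {0}"
proof -
  have "y = 0" if "y \<in> J" "y \<in> K" for y
    using disjoint_J_K[OF that] by (simp add: disjoint_elems_self_iff)
  then show ?thesis
    using J_subspace K_subspace by (auto intro: subspace_0)
qed

lemma J_K_splitting: "direct_sum_decomposition J K"
proof -
  have "y \<in> {a + c |a c. a \<in> J \<and> c \<in> K}" for y
    by (rule J_K_decompose[of y]) blast
  then show ?thesis
    unfolding direct_sum_decomposition_def
    using J_subspace K_subspace J_inter_K by blast
qed

lemma i_mem_J: "b \<in> B \<Longrightarrow> i b \<in> J"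
proof -
  assume b: "b \<in> B"
  obtain b' c where d: "b' \<in> B" "c \<in> C" "0 \<le> b'" "0 \<le> c" "modulus (i b) \<le> i b' + i c"
    by (rule dominate_modulus)
  \<comment> \<open>As \<open>b\<close> is disjoint from \<open>c\<close>, the majorant \<open>b' + c\<close> may be replaced by \<open>b'\<close>.\<close>
  have "inf (modulus (i b)) (i c) = 0"
    using disjoint_B_C[OF b d(2)] d(4)
    by (simp add: disjoint_elems_iff_inf modulus_of_nonneg i_nonneg_iff)
  moreover have "modulus (i b) = inf (modulus (i b)) (i b' + i c)"
    using d(5) by (simp add: inf_absorb1)
  moreover have "\<dots> \<le> inf (modulus (i b)) (i b') + inf (modulus (i b)) (i c)"
    using d by (intro inf_add_le) (simp_all add: modulus_nonneg i_nonneg_iff)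
  ultimately have "modulus (i b) \<le> i b'" by (metis add.right_neutral le_inf_iff)
  then show "i b \<in> J" using d unfolding dominated_by_def by blast
qed

lemma preimage_J: "{x. i x \<in> J} = B"
proof
  show "{x. i x \<in> J} \<subseteq> B"
  proof
    fix x assume "x \<in> {x. i x \<in> J}"
    then have "disjoint_elems x c" if "c \<in> C" for c
      using that disjoint_J_K[of "i x" "i c"] band_splitting.i_mem_J[OF swapped that]
      by (simp add: disjoint_iff)
    then show "x \<in> B"
      using compl_C unfolding disjoint_compl_def by blast
  qed
qed (auto intro: i_mem_J)

lemma B_order_ideal: "order_ideal B"
  unfolding order_ideal_def solid_def upper_bounds_subset_iff
  using subspaces(1) J_solid preimage_J by blast

lemma B_band: "is_band B"
  by (simp add: is_band_def subspaces compl_B compl_C)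

lemma extension_ideal_J: "extension_ideal i B J"
  by (simp add: extension_ideal_def B_order_ideal J_order_ideal preimage_J)

lemma extension_band_J: "extension_band i B J"
  by (simp add: extension_band_def B_band J_band preimage_J)

lemma extension_ideal_unique:
  assumes "extension_ideal i B L"
  shows "L = J"
proof -
  have L: "subspace L" "\<And>x y. y \<in> L \<Longrightarrow> modulus x \<le> modulus y \<Longrightarrow> x \<in> L" "B = {x. i x \<in> L}"
    using assms unfolding extension_ideal_def order_ideal_def solid_iff_modulus by blast+
  have "J \<subseteq> L"
  proof
    fix y assume "y \<in> J"
    then obtain b where "b \<in> B" "modulus y \<le> i b"
      unfolding dominated_by_def by blast
    then show "y \<in> L" using L(2)[of "i b" y] L(3) le_modulus(1)[of "i b"] by auto
  qed
  moreover have "y \<in> J" if y: "y \<in> L" for y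
  proof -
    obtain y1 y2 where s: "y1 \<in> J" "y2 \<in> K" "y = y1 + y2"
      by (rule J_K_decompose)
    have "y2 \<in> L"
      using subspace_diff[OF L(1) y, of y1] s \<open>J \<subseteq> L\<close> by auto
    have "y2 = 0"
    proof (rule ccontr)
      assume "y2 \<noteq> 0"
      then obtain x where x: "0 < i x" "i x \<le> modulus y2"
        using perv unfolding pervasive_in_def
        by (metis UNIV_I modulus_nonneg modulus_zero_iff)
      then have "modulus (i x) \<le> modulus y2"
        by (simp add: modulus_of_nonneg)
      then have "x \<in> B" "i x \<in> K"
        using L(2,3) \<open>y2 \<in> L\<close> K_solid s(2) by blast+
      then have "i x = 0"
        using i_mem_J J_inter_K by blast
      then show False using x by simp
    qed
    then show ?thesis using s by simp
  qed
  ultimately show ?thesis by blast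
qed

lemma extension_band_unique:
  assumes "extension_band i B L"
  shows "L = J"
proof (rule extension_ideal_unique)
  show "extension_ideal i B L"
    using assms band_imp_order_ideal B_order_ideal
    unfolding extension_band_def extension_ideal_def by blast
qed

lemma smallest_extension_ideal_eq: "smallest_extension_ideal i B = J"
proof -
  have "{L. extension_ideal i B L} = {J}"
    using extension_ideal_J extension_ideal_unique by blast
  then show ?thesis by (simp add: smallest_extension_ideal_def)
qed

lemma smallest_extension_band_eq: "smallest_extension_band i B = J"
proof -
  have "{L. extension_band i B L} = {J}"
    using extension_band_J extension_band_unique by blast
  then show ?thesis by (simp add: smallest_extension_band_def)
qed

lemma subspace_image: "subspace (i ` B)"
proof -
  have "linear i" by (rule linearI) (simp_all add: i_add i_scale)
  then show ?thesis using subspaces(1) by (rule linear_subspace_image)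
qed

lemma majorizing_J: "majorizing (i ` B) J"
  unfolding majorizing_def
  using subspace_image i_mem_J by (auto simp: dominated_by_def modulus_le_iff)

lemma vector_lattice_J: "is_vector_lattice J"
  unfolding is_vector_lattice_def
proof (intro conjI ballI)
  fix x y assume xy: "x \<in> J" "y \<in> J"
  then obtain a b where ab: "a \<in> B" "b \<in> B" "modulus x \<le> i a" "modulus y \<le> i b"
    unfolding dominated_by_def by blast
  have le: "modulus x \<le> i a + i b" "modulus y \<le> i a + i b"
    using ab modulus_nonneg[of x] modulus_nonneg[of y]
    by (meson add_increasing add_increasing2 order_trans)+
  have "modulus (sup x y) \<le> i (a + b)" "modulus (inf x y) \<le> i (a + b)"
    using le unfolding modulus_le_iff i_add
    by (auto simp: minus_le_iff[of "sup x y"] minus_le_iff[of "inf x y"] minus_le_iff[of x]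
        minus_le_iff[of y] intro: le_supI1 le_infI1)
  then have "sup x y \<in> J" "inf x y \<in> J"
    using ab subspace_add[OF subspaces(1)] unfolding dominated_by_def by blast+
  moreover have "isLub J {x, y} (sup x y)" if "sup x y \<in> J"
    using that by (auto simp: isLub_def leastP_def isUb_def setle_def setge_def)
  moreover have "isGlb J {x, y} (inf x y)" if "inf x y \<in> J"
    using that by (auto simp: isGlb_def greatestP_def isLb_def setle_def setge_def)
  ultimately show "\<exists>z. isLub J {x, y} z" "\<exists>z. isGlb J {x, y} z"
    by blast+
qed (rule J_subspace)

lemma order_dense_J: "order_dense (i ` B) J"
  unfolding order_dense_def
proof (intro conjI ballI subspace_image)
  show "i ` B \<subseteq> J" using i_mem_J by blast
next
  fix y assume y: "y \<in> J"
  have "w \<le> y" if w: "\<And>b. b \<in> B \<Longrightarrow> y \<le> i b \<Longrightarrow> w \<le> i b" for w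
  proof (rule le_by_density)
    fix x assume "y \<le> i x"
    obtain b c where x: "b \<in> B" "c \<in> C" "x = b + c"
      by (rule decompose)
    \<comment> \<open>\<open>i b - y\<close> and \<open>i c\<close> are the components of \<open>i x - y \<ge> 0\<close> in \<open>J\<close> and \<open>K\<close>.\<close>
    have d: "disjoint_elems (i b - y) (i c)"
      using x y J_subspace i_mem_J band_splitting.i_mem_J[OF swapped]
      by (simp add: disjoint_J_K subspace_diff)
    have "0 \<le> (i b - y) + i c"
      using \<open>y \<le> i x\<close> x by (simp add: i_add algebra_simps)
    then have "0 \<le> i b - y" "0 \<le> i c"
      using disjoint_sum_nonneg[OF d] disjoint_sum_nonneg[OF disjoint_elems_sym[OF d]]
      by (simp_all add: add.commute)
    then have "w \<le> i b" "i b \<le> i x"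
      using w x by (simp_all add: i_add)
    then show "w \<le> i x" by (rule order_trans)
  qed
  then show "isGlb J {z \<in> i ` B. y \<le> z} y"
    using y by (auto simp: isGlb_def greatestP_def isLb_def setle_def setge_def)
qed

lemma cover_J: "vector_lattice_cover B J i"
  using subspaces(1) vector_lattice_J order_dense_J bipositive
  by (simp add: vector_lattice_cover_def bipositive_linear_on_def)

lemma pervasive_B: "is_pervasive TYPE('b) B"
proof -
  have "pervasive_in B J i"
    unfolding pervasive_in_def
  proof (intro ballI impI)
    fix y assume y: "y \<in> J" "0 \<le> y \<and> y \<noteq> 0"
    then obtain x where x: "0 < i x" "i x \<le> y"
      using perv unfolding pervasive_in_def by blast
    then have "i x \<in> J"
      using y by (intro J_solid[OF y(1)]) (simp add: modulus_of_nonneg)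
    then show "\<exists>x\<in>B. 0 < i x \<and> i x \<le> y"
      using x preimage_J by blast
  qed
  then show ?thesis
    using cover_J unfolding is_pervasive_def by blast
qed

end

section \<open>The decomposition theorem\<close>

theorem theorem21:
  fixes i :: "'a::ordered_real_vector \<Rightarrow> 'b::{ordered_real_vector, lattice_ab_group_add}"
    and B :: "'a set" and Bhat Bdhat :: "'b set"
  assumes archimedean: "archimedean_order (UNIV :: 'a set)"
    and pre_riesz: "pre_riesz TYPE('z::ordered_real_vector) (UNIV :: 'a set)"
    and perv: "is_pervasive TYPE('z) (UNIV :: 'a set)"
    and band: "is_band B"
    and decomposition: "direct_sum_decomposition B (disjoint_compl B)"
    and cover: "vector_lattice_cover (UNIV :: 'a set) (UNIV :: 'b set) i"
    and Bhat: "Bhat = smallest_extension_ideal i B"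
    and Bdhat: "Bdhat = smallest_extension_ideal i (disjoint_compl B)"
  shows "direct_sum_decomposition Bhat (disjoint_compl Bhat) \<and>
    Bhat = smallest_extension_band i B \<and>
    (majorizing (i ` B) Bhat \<and>
      majorizing (i ` disjoint_compl B) (disjoint_compl Bhat)) \<and>
    disjoint_compl Bhat = Bdhat \<and>
    (extension_band i B Bhat \<and> extension_ideal i B Bhat \<and>
      (\<forall>J. extension_band i B J \<longrightarrow> J = Bhat) \<and>
      (\<forall>J. extension_ideal i B J \<longrightarrow> J = Bhat)) \<and>
    (vector_lattice_cover B Bhat i \<and>
      vector_lattice_cover (disjoint_compl B) (disjoint_compl Bhat) i \<and>
      is_pervasive TYPE('b) B \<and> is_pervasive TYPE('b) (disjoint_compl B))"
proof -
  interpret S: band_splitting i B "disjoint_compl B"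
    using cover pervasive_any_cover[OF perv cover] decomposition band
    by unfold_locales (simp_all add: is_band_def)
  interpret T: band_splitting i "disjoint_compl B" B
    by (rule S.swapped)
  have eqs: "Bhat = S.J" "Bdhat = S.K"
    using Bhat Bdhat S.smallest_extension_ideal_eq T.smallest_extension_ideal_eq by simp_all
  show ?thesis
    unfolding eqs S.disjoint_compl_J S.smallest_extension_band_eq
    using S.J_K_splitting S.majorizing_J T.majorizing_J S.extension_band_J S.extension_ideal_J
      S.extension_band_unique S.extension_ideal_unique S.cover_J T.cover_J
      S.pervasive_B T.pervasive_B
    by blast
qed

end
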